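(* Let $\langle X,\mathcal{M},\mathbf{O}\rangle$ be a measurement scenario (with $X$ a possibly infinite set of measurement labels and arbitrary measurable outcome spaces) and let $e=(e_C)_{C\in\mathcal{M}}$ be an empirical model on it. The following are equivalent: (1) $e$ is extendable; (2) $e$ admits a realisation by a deterministic hidden-variable model; (3) $e$ admits a realisation by a factorisable hidden-variable model.
   Context: A measurement scenario $\langle X,\mathcal{M},\mathbf{O}\rangle$ consists of: a (possibly infinite) set $X$ of measurement labels; a family $\mathcal{M}$ of subsets of $X$ with $\bigcup\mathcal{M}=X$ that is an anti-chain for inclusion (its elements are called maximal contexts); and, for each $x\in X$, a measurable space $\mathbf{O}_x=\langle O_x,\mathcal{F}_x\rangle$. For $U\subseteq X$, $\mathbf{O}_U=\langle O_U,\mathcal{F}_U\rangle$ denotes the product measurable space $\prod_{x\in U}\mathbf{O}_x$, where $O_U=\prod_{x\in U}O_x$ and $\mathcal{F}_U$ is the product $\sigma$-algebra (generated by cylinders $\prod_{x\in U}E_x$ with $E_x\in\mathcal{F}_x$ and $E_x\neq O_x$ for only finitely many $x$). For $U\subseteq V$ and a measure $\mu$ on $\mathbf{O}_V$, $\mu|_U$ denotes the marginal, i.e. the push-forward of $\mu$ along the projection $O_V\to O_U$. An empirical model $e$ on the scenario is a family $(e_C)_{C\in\mathcal{M}}$, where $e_C$ is a probability measure on $\mathbf{O}_C$, such that $e_C|_{C\cap C'}=e_{C'}|_{C\cap C'}$ for all $C,C'\in\mathcal{M}$. $e$ is extendable (noncontextual) if there is a probability measure $\mu$ on $\mathbf{O}_X$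 with $\mu|_C=e_C$ for all $C\in\mathcal{M}$. A hidden-variable model on the scenario is a triple $\langle\mathbf{\Lambda},p,k\rangle$ where $\mathbf{\Lambda}=\langle\Lambda,\mathcal{F}_\Lambda\rangle$ is a measurable space, $p$ is a probability measure on $\mathbf{\Lambda}$, and $k=(k_C)_{C\in\mathcal{M}}$ is a family of probability (Markov) kernels $k_C:\Lambda\times\mathcal{F}_C\to[0,1]$ from $\mathbf{\Lambda}$ to $\mathbf{O}_C$ (measurable in the first argument, a probability measure in the second) such that for all $C,C'\in\mathcal{M}$ and all $\lambda\in\Lambda$, $k_C(\lambda,-)|_{C\cap C'}=k_{C'}(\lambda,-)|_{C\cap C'}$. It realises the empirical model $e$ if $e_C(B)=\int_\Lambda k_C(\lambda,B)\,dp(\lambda)$ for all $C\in\mathcal{M}$ and $B\in\mathcal{F}_C$. The hidden-variable model is deterministic if for every $\lambda\in\Lambda$ and $C\in\mathcal{M}$ there is $\mathbf{o}\in O_C$ with $k_C(\lambda,-)=\delta_{\mathbf{o}}$, the Dirac measure at $\mathbf{o}$ (i.e. $\delta_{\mathbf{o}}(E)=1$ if $\mathbf{o}\in E$ and $0$ otherwise). It is factorisable if for every $\lambda\in\Lambda$, every $C\in\mathcal{M}$ and every family $(B_x\in\mathcal{F}_x)_{x\in C}$ with $B_x\neq O_x$ for only finitely many $x\in C$, one has $k_C(\lambda,\prod_{x\in C}B_x)=\prod_{x\in C}k_C|_{\{x\}}(\lambda,B_x)$, where $k_C|_{\{x\}}(\lambda,-)$ is the marginal of $k_C(\lambda,-)$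 on $\mathbf{O}_x$. *)

theory Defs
  imports "HOL-Probability.Probability"
begin

(* A scenario is given by X, M and Out, with Out x the measurable space of outcomes of x.
   Only the sigma-algebra of Out x matters; its measure is never used. No condition is imposed
   on Out, which is why it is not an argument here. *)
definition measurement_scenario :: "'x set \<Rightarrow> 'x set set \<Rightarrow> bool" where
  "measurement_scenario X M \<longleftrightarrow>
     \<Union> M = X \<and> (\<forall>C\<in>M. \<forall>C'\<in>M. C \<subseteq> C' \<longrightarrow> C = C')"

definition marginal ::
  "('x \<Rightarrow> 'o measure) \<Rightarrow> 'x set \<Rightarrow> ('x \<Rightarrow> 'o) measure \<Rightarrow> ('x \<Rightarrow> 'o) measure" where
  "marginal Out U \<mu> = distr \<mu> (PiM U Out) (\<lambda>f. restrict f U)"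

(* The marginal at a single label, as a measure on Out x itself instead of on the product
   over {x}. *)
definition marginal_at ::
  "('x \<Rightarrow> 'o measure) \<Rightarrow> 'x \<Rightarrow> ('x \<Rightarrow> 'o) measure \<Rightarrow> 'o measure" where
  "marginal_at Out x \<mu> = distr \<mu> (Out x) (\<lambda>f. f x)"

definition prob_measure_on :: "'a measure \<Rightarrow> 'a measure \<Rightarrow> bool" where
  "prob_measure_on N \<mu> \<longleftrightarrow> sets \<mu> = sets N \<and> prob_space \<mu>"

definition empirical_model ::
  "'x set set \<Rightarrow> ('x \<Rightarrow> 'o measure) \<Rightarrow> ('x set \<Rightarrow> ('x \<Rightarrow> 'o) measure) \<Rightarrow> bool" where
  "empirical_model M Out e \<longleftrightarrow>
     (\<forall>C\<in>M. prob_measure_on (PiM C Out) (e C)) \<and>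
     (\<forall>C\<in>M. \<forall>C'\<in>M. marginal Out (C \<inter> C') (e C) = marginal Out (C \<inter> C') (e C'))"

definition extendable ::
  "'x set \<Rightarrow> 'x set set \<Rightarrow> ('x \<Rightarrow> 'o measure) \<Rightarrow> ('x set \<Rightarrow> ('x \<Rightarrow> 'o) measure) \<Rightarrow> bool" where
  "extendable X M Out e \<longleftrightarrow>
     (\<exists>\<mu>. prob_measure_on (PiM X Out) \<mu> \<and> (\<forall>C\<in>M. marginal Out C \<mu> = e C))"

(* The measurable space Lambda of a hidden-variable model is the one underlying p.
   Measurability into prob_algebra is the library's notion of Markov kernel; see
   markov_kernel_iff below. *)
definition hidden_variable_model ::
  "'x set set \<Rightarrow> ('x \<Rightarrow> 'o measure) \<Rightarrow>
   'l measure \<Rightarrow> ('x set \<Rightarrow> 'l \<Rightarrow> ('x \<Rightarrow> 'o) measure) \<Rightarrow> bool" where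
  "hidden_variable_model M Out p k \<longleftrightarrow>
     prob_space p \<and>
     (\<forall>C\<in>M. k C \<in> p \<rightarrow>\<^sub>M prob_algebra (PiM C Out)) \<and>
     (\<forall>C\<in>M. \<forall>C'\<in>M. \<forall>l\<in>space p.
        marginal Out (C \<inter> C') (k C l) = marginal Out (C \<inter> C') (k C' l))"

lemma markov_kernel_iff:
  "k \<in> L \<rightarrow>\<^sub>M prob_algebra N \<longleftrightarrow>
     (\<forall>l\<in>space L. prob_measure_on N (k l)) \<and>
     (\<forall>B\<in>sets N. (\<lambda>l. emeasure (k l) B) \<in> borel_measurable L)"
proof
  assume k: "k \<in> L \<rightarrow>\<^sub>M prob_algebra N"
  show "(\<forall>l\<in>space L. prob_measure_on N (k l)) \<and>
     (\<forall>B\<in>sets N. (\<lambda>l. emeasure (k l) B) \<in> borel_measurable L)"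
    using measurable_space[OF k] measurable_emeasure_kernel[OF measurable_prob_algebraD[OF k]]
    by (auto simp: prob_measure_on_def space_prob_algebra)
next
  assume *: "(\<forall>l\<in>space L. prob_measure_on N (k l)) \<and>
     (\<forall>B\<in>sets N. (\<lambda>l. emeasure (k l) B) \<in> borel_measurable L)"
  show "k \<in> L \<rightarrow>\<^sub>M prob_algebra N"
    using * by (intro measurable_prob_algebraI measurable_subprob_algebra)
      (auto simp: prob_measure_on_def prob_space_imp_subprob_space)
qed

definition realises ::
  "'x set set \<Rightarrow> ('x \<Rightarrow> 'o measure) \<Rightarrow>
   'l measure \<Rightarrow> ('x set \<Rightarrow> 'l \<Rightarrow> ('x \<Rightarrow> 'o) measure) \<Rightarrow>
   ('x set \<Rightarrow> ('x \<Rightarrow> 'o) measure) \<Rightarrow> bool" where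
  "realises M Out p k e \<longleftrightarrow>
     (\<forall>C\<in>M. \<forall>B\<in>sets (PiM C Out). emeasure (e C) B = (\<integral>\<^sup>+ l. emeasure (k C l) B \<partial>p))"

definition deterministic ::
  "'x set set \<Rightarrow> ('x \<Rightarrow> 'o measure) \<Rightarrow>
   'l measure \<Rightarrow> ('x set \<Rightarrow> 'l \<Rightarrow> ('x \<Rightarrow> 'o) measure) \<Rightarrow> bool" where
  "deterministic M Out p k \<longleftrightarrow>
     (\<forall>l\<in>space p. \<forall>C\<in>M. \<exists>\<omega>\<in>space (PiM C Out). k C l = return (PiM C Out) \<omega>)"

(* The product over all x in C is taken over the finitely many x with B x distinct from the
   whole outcome space: the remaining factors are 1, whereas the library's product over an
   infinite index set would be 1 by convention, whatever the factors. *)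
definition factorisable ::
  "'x set set \<Rightarrow> ('x \<Rightarrow> 'o measure) \<Rightarrow>
   'l measure \<Rightarrow> ('x set \<Rightarrow> 'l \<Rightarrow> ('x \<Rightarrow> 'o) measure) \<Rightarrow> bool" where
  "factorisable M Out p k \<longleftrightarrow>
     (\<forall>l\<in>space p. \<forall>C\<in>M. \<forall>B.
        (\<forall>x\<in>C. B x \<in> sets (Out x)) \<and> finite {x \<in> C. B x \<noteq> space (Out x)} \<longrightarrow>
        emeasure (k C l) (Pi\<^sub>E C B) =
          (\<Prod>x\<in>{x \<in> C. B x \<noteq> space (Out x)}. emeasure (marginal_at Out x (k C l)) (B x)))"

(* The type argument is the type of hidden variables, which HOL cannot quantify over
   existentially. *)
definition has_deterministic_realisation ::
  "'l itself \<Rightarrow> 'x set set \<Rightarrow> ('x \<Rightarrow> 'o measure) \<Rightarrow> ('x set \<Rightarrow> ('x \<Rightarrow> 'o) measure) \<Rightarrow> bool" where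
  "has_deterministic_realisation _ M Out e \<longleftrightarrow>
     (\<exists>(p :: 'l measure) k.
        hidden_variable_model M Out p k \<and> deterministic M Out p k \<and> realises M Out p k e)"

definition has_factorisable_realisation ::
  "'l itself \<Rightarrow> 'x set set \<Rightarrow> ('x \<Rightarrow> 'o measure) \<Rightarrow> ('x set \<Rightarrow> ('x \<Rightarrow> 'o) measure) \<Rightarrow> bool" where
  "has_factorisable_realisation _ M Out e \<longleftrightarrow>
     (\<exists>(p :: 'l measure) k.
        hidden_variable_model M Out p k \<and> factorisable M Out p k \<and> realises M Out p k e)"

end

theory Submission
  imports Defs
begin

(* From an extension mu one gets a deterministic model with hidden variable a global assignment
   drawn from mu. Conversely, in a factorisable model compatibility makes the distribution of the
   outcome of a single label independent of the context, so each hidden variable determines an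
   (infinite) product measure on all labels; factorisability says that it restricts to the given
   kernels, and averaging it over the hidden variable yields an extension. *)

section \<open>Product kernels, marginals, and measures that factorise on boxes\<close>

lemma prod_emb_cong_sets:
  assumes "\<And>x. x \<in> I \<Longrightarrow> sets (M x) = sets (N x)"
  shows "prod_emb I M J A = prod_emb I N J A"
  using sets_eq_imp_space_eq[OF assms] by (simp add: prod_emb_def cong: PiE_cong)

text \<open>Measurability of a kernel need only be checked on an intersection-stable generator. On a
  cylinder the product measure is a finite product of the numbers
  \<open>emeasure (K j l) (E j)\<close>, each measurable in \<open>l\<close>, so \<open>I\<close>
  may be of any cardinality.\<close>

lemma measurable_PiM_prob_algebra:
  assumes K: "\<And>x. x \<in> I \<Longrightarrow> K x \<in> L \<rightarrow>\<^sub>M prob_algebra (N x)"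
  shows "(\<lambda>l. PiM I (\<lambda>x. K x l)) \<in> L \<rightarrow>\<^sub>M prob_algebra (PiM I N)"
proof (rule measurable_prob_algebra_generated[OF sets_PiM Int_stable_prod_algebra
      prod_algebra_sets_into_space])
  fix l assume l: "l \<in> space L"
  have *: "sets (K x l) = sets (N x)" "prob_space (K x l)" if "x \<in> I" for x
    using measurable_space[OF K[OF that] l] by (auto simp: space_prob_algebra)
  show "prob_space (PiM I (\<lambda>x. K x l))"
    by (rule prob_space_PiM) (rule *)
  show "sets (PiM I (\<lambda>x. K x l)) = sets (PiM I N)"
    by (rule sets_PiM_cong) (auto simp: *)
next
  fix A assume "A \<in> prod_algebra I N"
  from prod_algebraE[OF this] obtain J E
    where A: "A = prod_emb I N J (\<Pi>\<^sub>E j\<in>J. E j)" and J: "finite J" "J \<subseteq> I"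
    and E: "\<And>j. j \<in> J \<Longrightarrow> E j \<in> sets (N j)"
    by metis
  have "emeasure (PiM I (\<lambda>x. K x l)) A = (\<Prod>j\<in>J. emeasure (K j l) (E j))"
    if l: "l \<in> space L" for l
  proof -
    have *: "sets (K x l) = sets (N x)" "prob_space (K x l)" if "x \<in> I" for x
      using measurable_space[OF K[OF that] l] by (auto simp: space_prob_algebra)
    \<comment> \<open>The cylinder is formed with the spaces of \<open>N\<close>, while the product
      formula needs those of \<open>K x l\<close>; equal sigma-algebras have equal spaces.\<close>
    have "A = prod_emb I (\<lambda>x. K x l) J (Pi\<^sub>E J E)"
      unfolding A by (rule prod_emb_cong_sets) (simp add: *)
    then show ?thesis
      using J E * by (auto intro!: emeasure_PiM_emb)
  qed
  moreover have "(\<lambda>l. \<Prod>j\<in>J. emeasure (K j l) (E j)) \<in> borel_measurable L"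
  proof (rule borel_measurable_prod_ennreal)
    fix j assume "j \<in> J"
    with J E show "(\<lambda>l. emeasure (K j l) (E j)) \<in> borel_measurable L"
      by (intro measurable_emeasure_kernel[OF measurable_prob_algebraD[OF K]]) auto
  qed
  ultimately show "(\<lambda>l. emeasure (PiM I (\<lambda>x. K x l)) A) \<in> borel_measurable L"
    by (simp cong: measurable_cong)
qed

text \<open>Restriction to \<open>C\<close> is reindexing along the inclusion of \<open>C\<close>
  into \<open>X\<close>, and reindexing a product of probability measures along an injection gives a
  product again.\<close>

lemma marginal_PiM:
  assumes "\<And>x. x \<in> X \<Longrightarrow> prob_space (K x)" "\<And>x. x \<in> X \<Longrightarrow> sets (K x) = sets (Out x)"
    and "C \<subseteq> X"
  shows "marginal Out C (PiM X K) = PiM C K"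
proof -
  have "marginal Out C (PiM X K) = distr (PiM X K) (PiM C K) (\<lambda>f. \<lambda>x\<in>C. f x)"
    unfolding marginal_def using assms by (intro distr_cong sets_PiM_cong) auto
  also have "\<dots> = PiM C K"
    using assms by (intro distr_PiM_reindex[where f = "\<lambda>x. x"]) auto
  finally show ?thesis .
qed

text \<open>Evaluation at \<open>x\<close> factors through restriction to \<open>U\<close>. This
  carries compatibility on overlaps of contexts down to single labels.\<close>

lemma marginal_at_marginal:
  assumes \<mu>: "sets \<mu> = sets (PiM C Out)" and U: "U \<subseteq> C" "x \<in> U"
  shows "marginal_at Out x (marginal Out U \<mu>) = marginal_at Out x \<mu>"
proof -
  have "(\<lambda>f. restrict f U) \<in> \<mu> \<rightarrow>\<^sub>M PiM U Out"
    using \<mu> U by (auto simp: measurable_cong_sets[OF \<mu> refl] intro: measurable_restrict_subset)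
  with U show ?thesis
    unfolding marginal_at_def marginal_def
    by (subst distr_distr) (auto simp: comp_def)
qed

text \<open>The hypothesis \<open>fact\<close> prescribes the same values on cylinders as the
  product of the one-label marginals. Cylinders form an intersection-stable generator, so the two
  finite measures coincide.\<close>

lemma factorising_measure_eq_PiM:
  assumes \<mu>: "prob_measure_on (PiM C Out) \<mu>"
    and fact: "\<And>B. (\<And>x. x \<in> C \<Longrightarrow> B x \<in> sets (Out x)) \<Longrightarrow>
      finite {x \<in> C. B x \<noteq> space (Out x)} \<Longrightarrow>
      emeasure \<mu> (Pi\<^sub>E C B) =
        (\<Prod>x\<in>{x \<in> C. B x \<noteq> space (Out x)}. emeasure (marginal_at Out x \<mu>) (B x))"
  shows "\<mu> = PiM C (\<lambda>x. marginal_at Out x \<mu>)"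
proof -
  have sets: "sets \<mu> = sets (PiM C Out)" and "prob_space \<mu>"
    using \<mu> by (auto simp: prob_measure_on_def)
  then interpret prob_space \<mu> by simp
  let ?K = "\<lambda>x. marginal_at Out x \<mu>"
  have setsK: "sets (?K x) = sets (Out x)" for x
    by (simp add: marginal_at_def)
  have K: "prob_space (?K x)" if "x \<in> C" for x
    unfolding marginal_at_def using that
    by (intro prob_space_distr) (simp add: measurable_cong_sets[OF sets refl])
  have PiM: "sets (PiM C ?K) = sets (PiM C Out)"
    by (rule sets_PiM_cong) (auto simp: setsK)
  show ?thesis
  proof (rule measure_eqI_PiM_infinite[OF sets PiM])
    show "finite_measure \<mu>" by unfold_locales
  next
    fix A J assume J: "finite J" "J \<subseteq> C" and A: "\<And>i. i \<in> J \<Longrightarrow> A i \<in> sets (Out i)"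
    \<comment> \<open>Padding with whole outcome spaces outside \<open>J\<close> turns the cylinder
      into a box over all of \<open>C\<close>, to which \<open>fact\<close> applies.\<close>
    define B where "B x = (if x \<in> J then A x else space (Out x))" for x
    have sub: "{x \<in> C. B x \<noteq> space (Out x)} \<subseteq> J"
      by (auto simp: B_def)
    have "prod_emb C Out J (Pi\<^sub>E J A) = Pi\<^sub>E C B"
      using J A sets.sets_into_space[OF A] unfolding B_def by (intro prod_emb_PiE) auto
    then have "emeasure \<mu> (prod_emb C Out J (Pi\<^sub>E J A)) =
        (\<Prod>x\<in>{x \<in> C. B x \<noteq> space (Out x)}. emeasure (?K x) (B x))"
      using fact[of B] finite_subset[OF sub J(1)] A by (simp add: B_def)
    \<comment> \<open>Some \<open>A x\<close> with \<open>x\<close> in \<open>J\<close> may be the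
      whole space. Such labels are missing from the product in \<open>fact\<close>, and each
      contributes a factor 1.\<close>
    also have "\<dots> = (\<Prod>x\<in>J. emeasure (?K x) (B x))"
    proof (rule prod.mono_neutral_left[OF J(1) sub], rule ballI)
      fix x assume "x \<in> J - {x \<in> C. B x \<noteq> space (Out x)}"
      then show "emeasure (?K x) (B x) = 1"
        using J prob_space.emeasure_space_1[OF K, of x]
        by (auto simp: sets_eq_imp_space_eq[OF setsK])
    qed
    also have "\<dots> = (\<Prod>x\<in>J. emeasure (?K x) (A x))"
      by (simp add: B_def)
    also have "\<dots> = emeasure (PiM C ?K) (prod_emb C ?K J (Pi\<^sub>E J A))"
      using J A K by (intro emeasure_PiM_emb[symmetric]) (auto simp: setsK)
    also have "prod_emb C ?K J (Pi\<^sub>E J A) = prod_emb C Out J (Pi\<^sub>E J A)"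
      by (rule prod_emb_cong_sets) (simp add: setsK)
    finally show "emeasure \<mu> (prod_emb C Out J (Pi\<^sub>E J A)) =
        emeasure (PiM C ?K) (prod_emb C Out J (Pi\<^sub>E J A))" .
  qed
qed

section \<open>Deterministic realisations and their factorisability\<close>

text \<open>Averaging the point masses at \<open>restrict f C\<close> over \<open>\<mu>\<close> is
  the same as pushing \<open>\<mu>\<close> forward along restriction, which yields
  \<open>e C\<close>.\<close>

lemma extendable_imp_deterministic:
  assumes "\<Union> M = X" and "extendable X M Out e"
  shows "has_deterministic_realisation TYPE('x \<Rightarrow> 'o) M (Out :: 'x \<Rightarrow> 'o measure) e"
proof -
  from assms(2) obtain \<mu> where sets: "sets \<mu> = sets (PiM X Out)" and prob: "prob_space \<mu>"
    and ext: "\<And>C. C \<in> M \<Longrightarrow> marginal Out C \<mu> = e C"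
    by (auto simp: extendable_def prob_measure_on_def)
  let ?k = "\<lambda>C f. return (PiM C Out) (restrict f C)"
  have restr: "(\<lambda>f. restrict f C) \<in> \<mu> \<rightarrow>\<^sub>M PiM C Out" if "C \<in> M" for C
    using that assms(1)
    by (auto simp: measurable_cong_sets[OF sets refl] intro!: measurable_restrict_subset)
  \<comment> \<open>Restricting \<open>f\<close> first to \<open>C\<close> and then to the overlap
    forgets \<open>C\<close>. The result depends on the overlap alone, which makes the kernels
    compatible.\<close>
  have marg: "marginal Out (C \<inter> D) (?k C f) = return (PiM (C \<inter> D) Out) (restrict f (C \<inter> D))"
    if "C \<in> M" "f \<in> space \<mu>" for C D f
    unfolding marginal_def using measurable_space[OF restr[OF that(1)] that(2)]
    by (subst distr_return) (auto intro!: measurable_restrict_subset simp: Int_absorb1 Int_absorb2)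
  have "hidden_variable_model M Out \<mu> ?k"
    unfolding hidden_variable_model_def
  proof (intro conjI ballI prob)
    show "?k C \<in> \<mu> \<rightarrow>\<^sub>M prob_algebra (PiM C Out)" if "C \<in> M" for C
      by (rule measurable_compose[OF restr[OF that] measurable_return_prob_space])
  next
    fix C C' f assume "C \<in> M" "C' \<in> M" "f \<in> space \<mu>"
    then show "marginal Out (C \<inter> C') (?k C f) = marginal Out (C \<inter> C') (?k C' f)"
      using marg[of C f C'] marg[of C' f C] by (simp add: Int_commute)
  qed
  moreover have "deterministic M Out \<mu> ?k"
    unfolding deterministic_def using measurable_space[OF restr] by blast
  moreover have "realises M Out \<mu> ?k e"
    unfolding realises_def
  proof (intro ballI)
    fix C B assume C: "C \<in> M" and B: "B \<in> sets (PiM C Out)"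
    have "emeasure (e C) B = emeasure (marginal Out C \<mu>) B"
      by (simp add: ext C)
    also have "\<dots> = (\<integral>\<^sup>+ f. indicator B (restrict f C) \<partial>\<mu>)"
      unfolding marginal_def using B nn_integral_distr[OF restr[OF C], of "indicator B"] by simp
    finally show "emeasure (e C) B = (\<integral>\<^sup>+ f. emeasure (?k C f) B \<partial>\<mu>)"
      using B by simp
  qed
  ultimately show ?thesis
    unfolding has_deterministic_realisation_def by blast
qed

text \<open>A point lies in a box exactly when each coordinate lies in its side, so the indicator of
  a box is a product of indicators; the marginals of a point mass are point masses.\<close>

lemma deterministic_imp_factorisable:
  assumes "deterministic M Out p k"
  shows "factorisable M Out p k"
  unfolding factorisable_def
proof (intro ballI allI impI, elim conjE)
  fix l C B
  assume l: "l \<in> space p" "C \<in> M" and B: "\<forall>x\<in>C. B x \<in> sets (Out x)"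
    and fin: "finite {x \<in> C. B x \<noteq> space (Out x)}"
  from assms l obtain \<omega> where \<omega>: "\<omega> \<in> space (PiM C Out)"
    and k: "k C l = return (PiM C Out) \<omega>"
    unfolding deterministic_def by blast
  let ?F = "{x \<in> C. B x \<noteq> space (Out x)}"
  \<comment> \<open>A box over an uncountable \<open>C\<close> need not be measurable. This one is,
    being a cylinder over the finite set \<open>?F\<close>.\<close>
  have PiE: "Pi\<^sub>E C B = prod_emb C Out ?F (Pi\<^sub>E ?F B)"
  proof (subst prod_emb_PiE)
    show "B x \<subseteq> space (Out x)" if "x \<in> ?F" for x
      using that B sets.sets_into_space by blast
  qed (auto intro!: PiE_cong split: if_splits)
  have "Pi\<^sub>E C B \<in> sets (PiM C Out)"
    unfolding PiE using B fin by (intro sets_PiM_I) auto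
  then have "emeasure (k C l) (Pi\<^sub>E C B) = indicator (Pi\<^sub>E C B) \<omega>"
    by (simp add: k)
  also have "\<dots> = indicator (prod_emb C Out ?F (Pi\<^sub>E ?F B)) \<omega>"
    using PiE by simp
  also have "\<dots> = (\<Prod>x\<in>?F. indicator (B x) (\<omega> x) :: ennreal)"
  proof (cases "\<forall>x\<in>?F. \<omega> x \<in> B x")
    case True
    with \<omega> have "\<omega> \<in> prod_emb C Out ?F (Pi\<^sub>E ?F B)"
      by (auto simp: prod_emb_def space_PiM)
    moreover have "(\<Prod>x\<in>?F. indicator (B x) (\<omega> x) :: ennreal) = 1"
      using True by (intro prod.neutral) auto
    ultimately show ?thesis by simp
  next
    case False
    then obtain x where x: "x \<in> ?F" "\<omega> x \<notin> B x" by blast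
    then have "\<omega> \<notin> prod_emb C Out ?F (Pi\<^sub>E ?F B)"
      by (auto simp: prod_emb_def PiE_iff restrict_def)
    moreover have "(\<Prod>x\<in>?F. indicator (B x) (\<omega> x) :: ennreal) = 0"
      using x by (intro prod_zero[OF fin]) auto
    ultimately show ?thesis by simp
  qed
  also have "\<dots> = (\<Prod>x\<in>?F. emeasure (marginal_at Out x (k C l)) (B x))"
  proof (rule prod.cong[OF refl])
    fix x assume "x \<in> ?F"
    then show "indicator (B x) (\<omega> x) = emeasure (marginal_at Out x (k C l)) (B x)"
      using B \<omega> by (simp add: k marginal_at_def distr_return[OF measurable_component_singleton])
  qed
  finally show "emeasure (k C l) (Pi\<^sub>E C B) =
      (\<Prod>x\<in>?F. emeasure (marginal_at Out x (k C l)) (B x))" .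
qed

lemma has_deterministic_imp_has_factorisable:
  "has_deterministic_realisation L M Out e \<Longrightarrow> has_factorisable_realisation L M Out e"
  unfolding has_deterministic_realisation_def has_factorisable_realisation_def
  using deterministic_imp_factorisable by blast

section \<open>Extensions from factorisable realisations\<close>

text \<open>\<open>realises\<close> only compares values on sets of \<open>PiM C Out\<close>; the
  assumption on \<open>sets (e C)\<close> turns this into an equality of measures.\<close>

lemma factorisable_imp_extendable:
  assumes X: "\<Union> M = X" and e: "\<And>C. C \<in> M \<Longrightarrow> sets (e C) = sets (PiM C Out)"
    and "has_factorisable_realisation TYPE('l) M Out e"
  shows "extendable X M Out e"
proof -
  from assms(3) obtain p :: "'l measure" and k where hvm: "hidden_variable_model M Out p k"
    and fact: "factorisable M Out p k" and real: "realises M Out p k e"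
    unfolding has_factorisable_realisation_def by blast
  have p: "prob_space p"
    and k: "\<And>C. C \<in> M \<Longrightarrow> k C \<in> p \<rightarrow>\<^sub>M prob_algebra (PiM C Out)"
    using hvm by (simp_all add: hidden_variable_model_def)
  have compat: "marginal Out (C \<inter> C') (k C l) = marginal Out (C \<inter> C') (k C' l)"
    if "C \<in> M" "C' \<in> M" "l \<in> space p" for C C' l
    using hvm that unfolding hidden_variable_model_def by blast
  have prob_k: "prob_measure_on (PiM C Out) (k C l)" if "C \<in> M" "l \<in> space p" for C l
    using measurable_space[OF k[OF that(1)] that(2)]
    by (simp add: space_prob_algebra prob_measure_on_def)
  have sets_k: "sets (k C l) = sets (PiM C Out)" if "C \<in> M" "l \<in> space p" for C l
    using prob_k[OF that] by (simp add: prob_measure_on_def)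
  have "\<forall>x\<in>X. \<exists>C. C \<in> M \<and> x \<in> C"
    using X by blast
  then obtain ctx where ctx: "\<And>x. x \<in> X \<Longrightarrow> ctx x \<in> M" "\<And>x. x \<in> X \<Longrightarrow> x \<in> ctx x"
    using bchoice[of X "\<lambda>x C. C \<in> M \<and> x \<in> C"] by blast
  \<comment> \<open>The context \<open>ctx x\<close> is an arbitrary choice, made independently of
    \<open>l\<close> so that \<open>K x\<close> inherits measurability from a single kernel.
    \<open>K_eq\<close> shows that any other context containing \<open>x\<close> gives the same
    distribution.\<close>
  define K where "K x l = marginal_at Out x (k (ctx x) l)" for x l
  have K_eq: "K x l = marginal_at Out x (k C l)"
    if "C \<in> M" "x \<in> C" "l \<in> space p" for x C l
  proof -
    have x: "x \<in> X" using that X by auto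
    \<comment> \<open>Both contexts contain \<open>x\<close>, so both one-label marginals can be
      computed through the overlap, where the kernels agree.\<close>
    let ?U = "ctx x \<inter> C"
    have "K x l = marginal_at Out x (marginal Out ?U (k (ctx x) l))"
      unfolding K_def using that x ctx
      by (intro marginal_at_marginal[symmetric, OF sets_k]) auto
    also have "\<dots> = marginal_at Out x (marginal Out ?U (k C l))"
      using compat[of "ctx x" C l] that x ctx by simp
    also have "\<dots> = marginal_at Out x (k C l)"
      using that x ctx by (intro marginal_at_marginal[OF sets_k]) auto
    finally show ?thesis .
  qed
  have K: "K x \<in> p \<rightarrow>\<^sub>M prob_algebra (Out x)" if "x \<in> X" for x
    unfolding K_def marginal_at_def using ctx[OF that]
    by (intro measurable_compose[OF k measurable_distr_prob_space]) auto
  have prob_K: "prob_space (K x l)" "sets (K x l) = sets (Out x)"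
    if "x \<in> X" "l \<in> space p" for x l
    using measurable_space[OF K that(2)] that by (auto simp: space_prob_algebra)
  \<comment> \<open>For fixed \<open>l\<close> all labels are made independent, including those that
    share no context.\<close>
  define \<kappa> where "\<kappa> l = PiM X (\<lambda>x. K x l)" for l
  have \<kappa>: "\<kappa> \<in> p \<rightarrow>\<^sub>M prob_algebra (PiM X Out)"
    unfolding \<kappa>_def by (rule measurable_PiM_prob_algebra) (rule K)
  have marg: "marginal Out C (\<kappa> l) = k C l" if C: "C \<in> M" and l: "l \<in> space p" for C l
  proof -
    have "marginal Out C (\<kappa> l) = PiM C (\<lambda>x. K x l)"
      unfolding \<kappa>_def using X C l by (intro marginal_PiM) (auto simp: prob_K)
    also have "\<dots> = PiM C (\<lambda>x. marginal_at Out x (k C l))"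
      using K_eq C l by (intro PiM_cong) auto
    also have "\<dots> = k C l"
      using fact C l unfolding factorisable_def
      by (intro factorising_measure_eq_PiM[symmetric, OF prob_k]) auto
    finally show ?thesis .
  qed
  have p': "p \<in> space (prob_algebra p)"
    using p by (simp add: space_prob_algebra)
  show ?thesis
    unfolding extendable_def
  proof (intro exI conjI ballI)
    show "prob_measure_on (PiM X Out) (p \<bind> \<kappa>)"
      unfolding prob_measure_on_def using prob_space_bind'[OF p' \<kappa>] sets_bind'[OF p' \<kappa>] by simp
  next
    fix C assume C: "C \<in> M"
    have restr: "(\<lambda>f. restrict f C) \<in> PiM X Out \<rightarrow>\<^sub>M PiM C Out"
      using X C by (intro measurable_restrict_subset) auto
    \<comment> \<open>Taking marginals commutes with averaging over the hidden variable, so the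
      identity \<open>marg\<close> for each \<open>l\<close> passes to the mixture.\<close>
    have "marginal Out C (p \<bind> \<kappa>) = p \<bind> (\<lambda>l. marginal Out C (\<kappa> l))"
      unfolding marginal_def
      by (rule distr_bind[OF measurable_prob_algebraD[OF \<kappa>] prob_space.not_empty[OF p] restr])
    also have "\<dots> = p \<bind> k C"
      using marg[OF C] by (intro bind_cong) auto
    also have "\<dots> = e C"
    proof (rule measure_eqI)
      show sets: "sets (p \<bind> k C) = sets (e C)"
        using sets_bind'[OF p' k[OF C]] e[OF C] by simp
      fix B assume "B \<in> sets (p \<bind> k C)"
      then have "B \<in> sets (PiM C Out)"
        using sets e[OF C] by simp
      then show "emeasure (p \<bind> k C) B = emeasure (e C) B"
        using real C by (simp add: realises_def emeasure_bind_prob_algebra[OF p' k[OF C]])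
    qed
    finally show "marginal Out C (p \<bind> \<kappa>) = e C" .
  qed
qed

text \<open>The equivalences are stated for global assignments as hidden variables, the type on
  which an extension yields a realisation. The last two conjuncts leave \<open>'l\<close> arbitrary:
  no other type of hidden variables realises more models.\<close>

theorem theorem1:
  fixes X :: "'x set"
    and M :: "'x set set"
    and Out :: "'x \<Rightarrow> 'o measure"
    and e :: "'x set \<Rightarrow> ('x \<Rightarrow> 'o) measure"
  assumes "measurement_scenario X M"
    and "empirical_model M Out e"
  shows "(extendable X M Out e \<longleftrightarrow> has_deterministic_realisation TYPE('x \<Rightarrow> 'o) M Out e) \<and>
         (extendable X M Out e \<longleftrightarrow> has_factorisable_realisation TYPE('x \<Rightarrow> 'o) M Out e) \<and>
         (has_deterministic_realisation TYPE('l) M Out e \<longrightarrow> extendable X M Out e) \<and>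
         (has_factorisable_realisation TYPE('l) M Out e \<longrightarrow> extendable X M Out e)"
proof -
  have X: "\<Union> M = X" and e: "\<And>C. C \<in> M \<Longrightarrow> sets (e C) = sets (PiM C Out)"
    using assms by (auto simp: measurement_scenario_def empirical_model_def prob_measure_on_def)
  have "extendable X M Out e \<Longrightarrow> has_deterministic_realisation TYPE('x \<Rightarrow> 'o) M Out e"
    by (rule extendable_imp_deterministic[OF X])
  moreover have "has_factorisable_realisation TYPE('x \<Rightarrow> 'o) M Out e \<Longrightarrow> extendable X M Out e"
    and "has_factorisable_realisation TYPE('l) M Out e \<Longrightarrow> extendable X M Out e"
    by (rule factorisable_imp_extendable[OF X e]; assumption)+
  moreover have "has_deterministic_realisation TYPE('x \<Rightarrow> 'o) M Out e \<Longrightarrow>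
      has_factorisable_realisation TYPE('x \<Rightarrow> 'o) M Out e"
    and "has_deterministic_realisation TYPE('l) M Out e \<Longrightarrow>
      has_factorisable_realisation TYPE('l) M Out e"
    by (rule has_deterministic_imp_has_factorisable; assumption)+
  ultimately show ?thesis
    by blast
qed

end
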